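(* The longest $(9/4)$-free word over the ternary alphabet $\{0,1,2\}$ whose curling-number transform is overlap-free has length $84$. That is, there exists a $(9/4)$-free ternary word $x$ of length $84$ with $C(x)$ overlap-free, and there is no such word of length greater than $84$.
   Context: Words are indexed from $0$: a finite word of length $n$ is $x = x[0]x[1]\cdots x[n-1]$, and $x[i..j]$ denotes the factor (contiguous block) $x[i]\cdots x[j]$. A finite word $x$ of length $n \ge 1$ has period $p$, $1\le p\le n$, if $x[i]=x[i+p]$ for all $0\le i<n-p$; its exponent is $n/p$ where $p$ is its least period. A word is $\alpha$-free if it has no nonempty finite factor of exponent at least $\alpha$. An overlap is a word of the form $a x a x a$ with $a$ a single letter and $x$ a possibly empty word; a word is overlap-free if it contains no overlap as a factor (equivalently, it has no factor of exponent strictly greater than $2$). The curling number of a nonempty finite word $u$ is the largest integer $k \ge 1$ such that $u = y z^k$ for some (possibly empty) word $y$ and some nonempty word $z$. For a finite or infinite word $x$, the curling-number transform $C(x)$ is the word over the positive integers, of the same length as $x$, whose $i$-th letter $C(x)[i]$ is the curling number of the prefix $x[0..i]$. *)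

theory Defs
  imports Complex_Main "HOL-Library.Sublist"
begin

text \<open>Finite words are lists; infinite words are functions from the natural numbers. A factor of
  a finite word is a contiguous block, i.e. \<open>sublist\<close> (not \<open>subseq\<close>).\<close>

definition inf_factor :: "'a list \<Rightarrow> (nat \<Rightarrow> 'a) \<Rightarrow> bool" where
  "inf_factor u x \<longleftrightarrow> (\<exists>i. u = map x [i..<i + length u])"

definition has_period :: "'a list \<Rightarrow> nat \<Rightarrow> bool" where
  "has_period x p \<longleftrightarrow> 1 \<le> p \<and> p \<le> length x \<and> (\<forall>i < length x - p. x ! i = x ! (i + p))"

text \<open>Only meaningful for nonempty words, which always have their length as a period.\<close>

definition exponent :: "'a list \<Rightarrow> real" where
  "exponent x = real (length x) / real (LEAST p. has_period x p)"

definition power_free :: "real \<Rightarrow> 'a list \<Rightarrow> bool" where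
  "power_free \<alpha> x \<longleftrightarrow> \<not> (\<exists>u. sublist u x \<and> u \<noteq> [] \<and> exponent u \<ge> \<alpha>)"

definition inf_power_free :: "real \<Rightarrow> (nat \<Rightarrow> 'a) \<Rightarrow> bool" where
  "inf_power_free \<alpha> x \<longleftrightarrow> \<not> (\<exists>u. inf_factor u x \<and> u \<noteq> [] \<and> exponent u \<ge> \<alpha>)"

definition is_overlap :: "'a list \<Rightarrow> bool" where
  "is_overlap u \<longleftrightarrow> (\<exists>a v. u = [a] @ v @ [a] @ v @ [a])"

definition overlap_free :: "'a list \<Rightarrow> bool" where
  "overlap_free x \<longleftrightarrow> \<not> (\<exists>u. sublist u x \<and> is_overlap u)"

definition inf_overlap_free :: "(nat \<Rightarrow> 'a) \<Rightarrow> bool" where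
  "inf_overlap_free x \<longleftrightarrow> \<not> (\<exists>u. inf_factor u x \<and> is_overlap u)"

text \<open>For nonempty \<open>u\<close> the set below contains \<open>1\<close> and is bounded by the length of \<open>u\<close>, so
  that \<open>Max\<close> is the true maximum; the value at the empty word is irrelevant.\<close>

definition curling_number :: "'a list \<Rightarrow> nat" where
  "curling_number u =
     Max {k. 1 \<le> k \<and> (\<exists>y z. z \<noteq> [] \<and> u = y @ concat (replicate k z))}"

definition curling_transform :: "'a list \<Rightarrow> nat list" where
  "curling_transform x = map (\<lambda>i. curling_number (take (Suc i) x)) [0..<length x]"

definition inf_curling_transform :: "(nat \<Rightarrow> 'a) \<Rightarrow> nat \<Rightarrow> nat" where
  "inf_curling_transform x = (\<lambda>i. curling_number (map x [0..<Suc i]))"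

end

theory Submission
  imports Defs
begin

text \<open>
  In a \<open>(9/4)\<close>-free word the curling number of a prefix is \<open>2\<close> if the prefix ends in a square and
  \<open>1\<close> otherwise. The upper bound is a search over the possible transforms \<open>c\<close>: for every
  overlap-free \<open>c\<close> one keeps the set of all words of length at most \<open>24\<close>, up to a permutation of the
  letters, that can be the suffix of a word with transform \<open>c\<close>. Such a suffix shows all squares of
  period at most \<open>12\<close> at its end. A square of period \<open>p \<ge> 13\<close> that is not accompanied by a shorter one
  would produce a suffix that also occurs \<open>p\<close> letters earlier, and comparing the current set of
  suffixes with the one belonging to the prefix of \<open>c\<close> that is shorter by \<open>p\<close> excludes this. Merging
  words with equal suffixes keeps the search small enough for the simplifier, and no set survives
  up to length \<open>85\<close>. The witness for length \<open>84\<close> is itself overlap-free.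

  Words under construction are stored with the newest letter first.
\<close>

section \<open>Periods, powers and curling numbers\<close>

text \<open>A prefix of \<open>y\<close> of length \<open>p + q\<close> has period \<open>p\<close>.\<close>

definition recurs :: "nat \<Rightarrow> nat \<Rightarrow> 'a list \<Rightarrow> bool" where
  "recurs q p y \<longleftrightarrow> p + q \<le> length y \<and> take q y = take q (drop p y)"

lemma recurs_nth: "recurs q p y \<Longrightarrow> i < q \<Longrightarrow> y ! i = y ! (i + p)"
  unfolding recurs_def
  by (metis add.commute add_leD1 le_add2 nth_drop nth_take order_trans)

lemma recurs_map_inj: "inj f \<Longrightarrow> recurs q p (map f y) \<longleftrightarrow> recurs q p y"
  by (simp add: recurs_def take_map drop_map inj_map_eq_map)

lemma recurs_map: "recurs q p y \<Longrightarrow> recurs q p (map f y)"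
  by (simp add: recurs_def take_map drop_map)

lemma recurs_take: "p + q \<le> k \<Longrightarrow> recurs q p (take k y) \<longleftrightarrow> recurs q p y"
  by (auto simp: recurs_def drop_take min_def)

lemma recurs_mono: "recurs q p y \<Longrightarrow> q' \<le> q \<Longrightarrow> recurs q' p y"
  unfolding recurs_def by (metis add_le_cancel_left min.absorb2 min.commute order_trans take_take)

lemma power_free_sublist: "power_free \<alpha> x \<Longrightarrow> sublist u x \<Longrightarrow> power_free \<alpha> u"
  unfolding power_free_def using sublist_order.order.trans by blast

lemma overlap_free_sublist: "overlap_free x \<Longrightarrow> sublist u x \<Longrightarrow> overlap_free u"
  unfolding overlap_free_def using sublist_order.order.trans by blast

lemma exponent_ge:
  assumes "has_period u p"
  shows "real (length u) / real p \<le> exponent u"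
proof -
  define l where "l = (LEAST p. has_period u p)"
  have "has_period u l" "l \<le> p"
    unfolding l_def using assms by (rule LeastI, rule Least_le)
  then have "0 < real l" "real l \<le> real p"
    by (auto simp: has_period_def)
  then show ?thesis
    unfolding exponent_def l_def[symmetric] by (intro divide_left_mono) auto
qed

text \<open>Reversal preserves periods, so the first \<open>p + q\<close> letters of
  \<open>y\<close> give a factor of \<open>rev y\<close> with period \<open>p\<close>. Its least
  period may be smaller, which only raises the exponent.\<close>

lemma recurs_power_free:
  assumes "power_free \<alpha> (rev y)" "recurs q p y" "1 \<le> p"
  shows "real (p + q) / real p < \<alpha>"
proof -
  let ?u = "rev (take (p + q) y)"
  have len: "length ?u = p + q"
    using assms(2) by (simp add: recurs_def)
  have "?u ! i = ?u ! (i + p)" if "i < q" for i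
  proof -
    have "y ! (q - 1 - i) = y ! (q - 1 - i + p)"
      using recurs_nth[OF assms(2), of "q - 1 - i"] that by simp
    moreover have "q - 1 - i + p = p + q - 1 - i"
      using that by simp
    ultimately show ?thesis
      using that len by (simp add: rev_nth add.commute)
  qed
  then have "has_period ?u p"
    using len assms(3) by (simp add: has_period_def)
  then have "real (p + q) / real p \<le> exponent ?u"
    using exponent_ge len by metis
  moreover have "sublist ?u (rev y)"
    by (simp add: sublist_rev sublist_take)
  moreover have "?u \<noteq> []"
    using len assms(3) by auto
  ultimately show ?thesis
    using assms(1) unfolding power_free_def by (meson not_le order_trans)
qed

lemma is_overlap_rev: "is_overlap (rev u) \<longleftrightarrow> is_overlap u"
proof -
  have "is_overlap (rev u)" if *: "is_overlap u" for u :: "'b list"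
  proof -
    obtain a v where "u = [a] @ v @ [a] @ v @ [a]"
      using * unfolding is_overlap_def by blast
    then have "rev u = [a] @ rev v @ [a] @ rev v @ [a]"
      by simp
    then show ?thesis
      unfolding is_overlap_def by blast
  qed
  from this[of u] this[of "rev u"] show ?thesis by auto
qed

lemma is_overlap_iff: "is_overlap u \<longleftrightarrow> (\<exists>p\<ge>1. length u = 2 * p + 1 \<and> recurs (p + 1) p u)"
proof
  assume "is_overlap u"
  then obtain a v where u: "u = [a] @ v @ [a] @ v @ [a]"
    unfolding is_overlap_def by blast
  then show "\<exists>p\<ge>1. length u = 2 * p + 1 \<and> recurs (p + 1) p u"
    by (intro exI[of _ "length v + 1"]) (simp add: recurs_def)
next
  assume "\<exists>p\<ge>1. length u = 2 * p + 1 \<and> recurs (p + 1) p u"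
  then obtain p where p: "1 \<le> p" "length u = 2 * p + 1" "take (p + 1) u = drop p u"
    by (auto simp: recurs_def)
  then obtain a v where av: "take p u = a # v"
    by (cases "take p u") auto
  have "drop p u = take p u @ [u ! p]"
    using p take_Suc_conv_app_nth[of p u] by simp
  then have u: "u = (a # v) @ (a # v) @ [u ! p]"
    by (metis append_take_drop_id av)
  moreover have "length v + 1 = p"
    using av p by (metis length_take min.absorb2 le_add2 length_Cons Suc_eq_plus1 mult_2 add.assoc trans_le_add2 le_add1)
  ultimately have "u ! p = a"
    by (metis Suc_eq_plus1 append_Cons length_Cons nth_append_length)
  with u show "is_overlap u"
    unfolding is_overlap_def by (intro exI[of _ a] exI[of _ v]) simp
qed

text \<open>Factors are prefixes of the suffixes \<open>drop n y\<close>, and \<open>recurs\<close>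
  sees only a prefix. Storing words backwards is harmless because the reversal of an overlap is an
  overlap.\<close>

lemma overlap_free_rev_iff:
  "overlap_free (rev y) \<longleftrightarrow> (\<forall>n p. 1 \<le> p \<longrightarrow> \<not> recurs (p + 1) p (drop n y))"
proof -
  have "overlap_free (rev y) \<longleftrightarrow> (\<forall>u. sublist u y \<longrightarrow> \<not> is_overlap u)"
    unfolding overlap_free_def by (metis is_overlap_rev rev_rev_ident sublist_rev)
  also have "\<dots> \<longleftrightarrow> (\<forall>n p. 1 \<le> p \<longrightarrow> \<not> recurs (p + 1) p (drop n y))"
  proof (intro iffI allI impI notI)
    fix n p :: nat
    assume *: "\<forall>u. sublist u y \<longrightarrow> \<not> is_overlap u" "1 \<le> p" "recurs (p + 1) p (drop n y)"
    let ?u = "take (2 * p + 1) (drop n y)"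
    have "recurs (p + 1) p ?u"
      using * by (simp add: recurs_take)
    moreover have "length ?u = 2 * p + 1"
      using *(3) by (simp add: recurs_def)
    moreover have "sublist ?u y"
      by (meson sublist_drop sublist_order.order.trans sublist_take)
    ultimately show False
      using * is_overlap_iff by blast
  next
    fix u
    assume *: "\<forall>n p. 1 \<le> p \<longrightarrow> \<not> recurs (p + 1) p (drop n y)" "sublist u y" "is_overlap u"
    then obtain a b where y: "y = a @ u @ b"
      by (auto simp: sublist_def)
    obtain p where p: "1 \<le> p" "length u = 2 * p + 1" "recurs (p + 1) p u"
      using * is_overlap_iff by blast
    have "recurs (p + 1) p (take (2 * p + 1) (drop (length a) y))"
      using y p by simp
    then have "recurs (p + 1) p (drop (length a) y)"
      using recurs_take[of p "p + 1" "2 * p + 1" "drop (length a) y"] by simp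
    with * p show False by blast
  qed
  finally show ?thesis .
qed

text \<open>An exponent above 2 with least period \<open>p\<close> forces \<open>2 * p + 1\<close>
  letters, and the first that many form an overlap. This gives the power-freeness of the
  witness.\<close>

lemma overlap_free_imp_power_free:
  assumes "overlap_free x"  "2 < \<alpha>"
  shows "power_free \<alpha> x"
  unfolding power_free_def
proof (intro notI, elim exE conjE)
  fix u
  assume u: "sublist u x" "u \<noteq> []" "\<alpha> \<le> exponent u"
  define p where "p = (LEAST p. has_period u p)"
  have "has_period u (length u)"
    using u by (cases u) (auto simp: has_period_def)
  then have p: "has_period u p"
    unfolding p_def by (rule LeastI)
  then have "0 < real p"
    by (simp add: has_period_def)
  moreover have "2 < real (length u) / real p"
    using u(3) assms(2) unfolding exponent_def p_def[symmetric] by linarith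
  ultimately have "2 * real p < real (length u)"
    by (simp add: pos_less_divide_eq)
  then have len: "2 * p + 1 \<le> length u" by linarith
  have eq: "take (p + 1) u = take (p + 1) (drop p u)"
  proof (rule nth_equalityI)
    show "length (take (p + 1) u) = length (take (p + 1) (drop p u))"
      using len by simp
    fix i assume "i < length (take (p + 1) u)"
    then show "take (p + 1) u ! i = take (p + 1) (drop p u) ! i"
      using p len by (simp add: has_period_def add.commute)
  qed
  then have "recurs (p + 1) p u"
    using len by (simp add: recurs_def)
  then have "recurs (p + 1) p (take (2 * p + 1) u)"
    by (simp add: recurs_take)
  moreover have "1 \<le> p"
    using p by (simp add: has_period_def)
  ultimately have "is_overlap (take (2 * p + 1) u)"
    using len by (subst is_overlap_iff) (intro exI[of _ p], auto)
  moreover have "sublist (take (2 * p + 1) u) x"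
    by (meson u(1) sublist_order.order.trans sublist_take)
  ultimately show False
    using assms(1) by (auto simp: overlap_free_def)
qed

lemma recurs_same_iff: "recurs p p y \<longleftrightarrow> (\<exists>z v. length z = p \<and> y = z @ z @ v)"
proof
  assume "recurs p p y"
  then have "p + p \<le> length y" "take p y = take p (drop p y)"
    by (auto simp: recurs_def)
  then have "y = take p y @ take p y @ drop p (drop p y)" "length (take p y) = p"
    by (metis append_take_drop_id, simp)
  then show "\<exists>z v. length z = p \<and> y = z @ z @ v" by blast
qed (auto simp: recurs_def)

text \<open>A cube at the end would have exponent at least 3, so only \<open>k = 1\<close> and
  \<open>k = 2\<close> remain, and \<open>k = 2\<close> means a square at the end.\<close>

lemma curling_number_rev:
  assumes "power_free (9/4) (rev y)" "y \<noteq> []"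
  shows "curling_number (rev y) = (if \<exists>p\<ge>1. recurs p p y then 2 else 1)"
proof -
  define K where "K = {k. 1 \<le> k \<and> (\<exists>v z. z \<noteq> [] \<and> rev y = v @ concat (replicate k z))}"
  have K_iff: "k \<in> K \<longleftrightarrow> 1 \<le> k \<and> (\<exists>z v. z \<noteq> [] \<and> y = concat (replicate k z) @ v)" for k
  proof -
    have *: "rev y = v @ concat (replicate k z) \<longleftrightarrow> y = concat (replicate k (rev z)) @ rev v" for v z
      by (simp add: rev_swap rev_concat)
    show ?thesis
      unfolding K_def mem_Collect_eq *
      by (rule arg_cong[where f = "\<lambda>b. 1 \<le> k \<and> b"]) (metis rev_is_Nil_conv rev_rev_ident)
  qed
  have one: "1 \<in> K"
    unfolding K_iff using assms(2) by (auto intro: exI[of _ y])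
  have two: "2 \<in> K \<longleftrightarrow> (\<exists>p\<ge>1. recurs p p y)"
  proof
    assume "2 \<in> K"
    then obtain z v where z: "z \<noteq> []" "y = concat (replicate 2 z) @ v"
      unfolding K_iff by blast
    then have "recurs (length z) (length z) y"
      by (simp add: recurs_def numeral_2_eq_2)
    moreover have "1 \<le> length z"
      using z(1) by (cases z) auto
    ultimately show "\<exists>p\<ge>1. recurs p p y" by blast
  next
    assume "\<exists>p\<ge>1. recurs p p y"
    then obtain p z v where z: "1 \<le> p" "length z = p" "y = z @ z @ v"
      unfolding recurs_same_iff by blast
    then have "z \<noteq> []" "y = concat (replicate 2 z) @ v"
      by (auto simp: numeral_2_eq_2)
    then show "2 \<in> K"
      unfolding K_iff by auto
  qed
  have three: "k \<le> 2" if "k \<in> K" for k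
  proof (rule ccontr)
    assume "\<not> k \<le> 2"
    then obtain j where k: "k = Suc (Suc (Suc j))"
      by (metis add_2_eq_Suc less_imp_Suc_add not_le add_Suc_right)
    obtain z v where z: "z \<noteq> []" "y = concat (replicate k z) @ v"
      using \<open>k \<in> K\<close> K_iff by blast
    then have "recurs (length z + length z) (length z) y"
      by (simp add: recurs_def k)
    moreover have "1 \<le> length z"
      using z(1) by (cases z) auto
    ultimately have "real (length z + (length z + length z)) / real (length z) < 9/4"
      using recurs_power_free assms(1) by blast
    then show False
      using z(1) by (simp add: field_simps)
  qed
  have "K = (if \<exists>p\<ge>1. recurs p p y then {1, 2} else {1})"
  proof -
    have "k = 1 \<or> k = 2" if "k \<in> K" for k
      using three[OF that] K_iff[of k] that by linarith
    with one two show ?thesis by auto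
  qed
  then show ?thesis
    unfolding curling_number_def K_def[symmetric] by simp
qed

lemma take_curling_transform: "take n (curling_transform x) = curling_transform (take n x)"
proof (rule nth_equalityI)
  fix i assume "i < length (take n (curling_transform x))"
  then have "i < length x" "i < n"
    by (auto simp: curling_transform_def)
  then show "take n (curling_transform x) ! i = curling_transform (take n x) ! i"
    by (simp add: curling_transform_def min_absorb1 Suc_leI)
qed (simp add: curling_transform_def)

section \<open>Executable tests on ternary words\<close>

datatype letter = LA | LB | LC

text \<open>The nine pairs of letters are spelled out so that each comparison is a single rewrite
  step.\<close>

fun agree :: "nat \<Rightarrow> letter list \<Rightarrow> letter list \<Rightarrow> bool" where
  "agree 0 y z = True"
| "agree (Suc n) [] z = False"
| "agree (Suc n) (a # y) [] = False"
| "agree (Suc n) (LA # y) (LA # z) = agree n y z"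
| "agree (Suc n) (LA # y) (LB # z) = False"
| "agree (Suc n) (LA # y) (LC # z) = False"
| "agree (Suc n) (LB # y) (LA # z) = False"
| "agree (Suc n) (LB # y) (LB # z) = agree n y z"
| "agree (Suc n) (LB # y) (LC # z) = False"
| "agree (Suc n) (LC # y) (LA # z) = False"
| "agree (Suc n) (LC # y) (LB # z) = False"
| "agree (Suc n) (LC # y) (LC # z) = agree n y z"

lemma agree_iff: "agree n y z \<longleftrightarrow> n \<le> length y \<and> n \<le> length z \<and> take n y = take n z"
  by (induction n y z rule: agree.induct) auto

text \<open>
  The simplifier evaluates arguments first and would evaluate both branches of a conditional. Here
  and below, auxiliary functions such as \<open>repeats_else\<close> therefore dispatch on an already computed
  condition by pattern matching.
\<close>

fun repeats :: "nat \<Rightarrow> nat \<Rightarrow> letter list \<Rightarrow> letter list \<Rightarrow> bool"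
  and repeats_else :: "bool \<Rightarrow> nat \<Rightarrow> nat \<Rightarrow> letter list \<Rightarrow> letter list \<Rightarrow> bool" where
  "repeats 0 q y z = False"
| "repeats (Suc m) q y [] = False"
| "repeats (Suc m) q y (b # z) = repeats_else (agree q y z) m q y z"
| "repeats_else True m q y z = True"
| "repeats_else False m q y z = repeats m (Suc q) y z"

lemma repeats_else_iff: "repeats_else b m q y z \<longleftrightarrow> b \<or> repeats m (Suc q) y z"
  by (cases b) auto

lemma repeats_iff:
  "repeats m q y z \<longleftrightarrow> (\<exists>i<m. i < length z \<and> agree (q + i) y (drop (Suc i) z))"
proof (induction m arbitrary: q z)
  case (Suc m)
  show ?case
  proof (cases z)
    case (Cons b z')
    have "(\<exists>i<Suc m. i < length z \<and> agree (q + i) y (drop (Suc i) z)) \<longleftrightarrow>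
      agree q y z' \<or> (\<exists>i<m. i < length z' \<and> agree (Suc q + i) y (drop (Suc i) z'))"
      unfolding Cons by (subst Ex_less_Suc2) simp
    then show ?thesis
      using Suc.IH[of "Suc q" z'] by (simp add: Cons repeats_else_iff)
  qed simp
qed simp

text \<open>Shift and required agreement grow together, so their difference \<open>q\<close> stays
  fixed: \<open>q = 0\<close> tests for squares and \<open>q = 1\<close> for overlaps at the newest
  end.\<close>

lemma repeats_recurs:
  "repeats m (Suc q) y y \<longleftrightarrow> (\<exists>p. 1 \<le> p \<and> p \<le> m \<and> recurs (p + q) p y)"
proof -
  have *: "i < length y \<and> agree (Suc q + i) y (drop (Suc i) y) \<longleftrightarrow> recurs (Suc i + q) (Suc i) y" for i
    unfolding agree_iff recurs_def by (auto simp: add.commute[of q])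
  have "(\<exists>i<m. P (Suc i)) \<longleftrightarrow> (\<exists>p. 1 \<le> p \<and> p \<le> m \<and> P p)" for P
  proof
    assume "\<exists>p. 1 \<le> p \<and> p \<le> m \<and> P p"
    then obtain p where "1 \<le> p" "p \<le> m" "P p" by blast
    then show "\<exists>i<m. P (Suc i)"
      by (intro exI[of _ "p - 1"]) auto
  next
    assume "\<exists>i<m. P (Suc i)"
    then obtain i where "i < m" "P (Suc i)" by blast
    then show "\<exists>p. 1 \<le> p \<and> p \<le> m \<and> P p"
      by (intro exI[of _ "Suc i"]) simp
  qed
  then show ?thesis
    unfolding repeats_iff * .
qed

section \<open>Words up to a permutation of the letters\<close>

text \<open>Move-to-front on the ranks of the letters by recency: the letter of rank \<open>b\<close> is read next.\<close>

fun front :: "letter \<Rightarrow> letter \<Rightarrow> letter" where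
  "front LA b = b"
| "front LB LA = LB" | "front LB LB = LA" | "front LB LC = LC"
| "front LC LA = LB" | "front LC LB = LC" | "front LC LC = LA"

fun rank :: "letter list \<Rightarrow> letter \<Rightarrow> letter" where
  "rank [] = id"
| "rank (a # y) = front (rank y a) \<circ> rank y"

text \<open>Letters are renamed by first occurrence, starting from the newest, which picks one
  representative of each word up to a permutation of the letters.\<close>

definition canon :: "letter list \<Rightarrow> letter list" where
  "canon y = map (rank y) y"

lemma front_self [simp]: "front b b = LA"
  by (cases b) auto

lemma inj_front: "inj (front b)"
proof (rule injI)
  fix x y assume "front b x = front b y"
  then show "x = y" by (cases b; cases x; cases y) auto
qed

lemma inj_rank: "inj (rank y)"
proof (induction y)
  case (Cons a y)
  then show ?case
    using inj_compose[OF inj_front Cons] by (simp only: rank.simps)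
qed simp

text \<open>A new letter enters only through its rank, so the search can work on canonical words
  alone.\<close>

lemma canon_Cons: "canon (a # y) = LA # map (front (rank y a)) (canon y)"
  by (simp add: canon_def)

fun precedes :: "letter \<Rightarrow> letter \<Rightarrow> bool" where
  "precedes LA b = (b \<noteq> LA)" | "precedes LB b = (b = LC)" | "precedes LC b = False"

lemma precedes_front:
  "precedes r s \<Longrightarrow> r \<noteq> d \<Longrightarrow> s \<noteq> d \<Longrightarrow> precedes (front d r) (front d s)"
  by (cases d; cases r; cases s) auto

text \<open>Moving any letter from behind \<open>r\<close> to the front pushes \<open>r\<close> back
  by exactly one place.\<close>

lemma front_precedes: "precedes r d \<Longrightarrow> precedes r d' \<Longrightarrow> front d r = front d' r"
  by (cases d; cases d'; cases r) auto

lemma rank_precedes: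
  "a \<in> set y \<Longrightarrow> c \<notin> set y \<Longrightarrow> precedes (rank (y @ z) a) (rank (y @ z) c)"
proof (induction y)
  case (Cons d y)
  have ne: "rank (y @ z) u \<noteq> rank (y @ z) v" if "u \<noteq> v" for u v
    using that inj_rank[of "y @ z"] by (auto dest: injD)
  show ?case
  proof (cases "a = d")
    case True
    then have "front (rank (y @ z) d) (rank (y @ z) c) \<noteq> LA"
      using ne[of c d] Cons.prems inj_front[of "rank (y @ z) d"]
      by (metis front_self injD list.set_intros(1))
    with True show ?thesis by simp
  next
    case False
    with Cons show ?thesis by (auto intro!: precedes_front ne)
  qed
qed simp

text \<open>The rank of a letter of \<open>y\<close> counts the distinct letters read after its
  latest occurrence, so the older part \<open>z\<close> cannot affect it.\<close>

lemma rank_append: "a \<in> set y \<Longrightarrow> rank (y @ z) a = rank y a"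
proof (induction y arbitrary: a)
  case (Cons d y)
  show ?case
  proof (cases "a = d")
    case False
    then have a: "a \<in> set y" using Cons by simp
    show ?thesis
    proof (cases "d \<in> set y")
      case True
      with a show ?thesis by (simp add: Cons.IH)
    next
      \<comment> \<open>The rank of \<open>d\<close> may depend on \<open>z\<close>, but
        \<open>d\<close> lies behind \<open>a\<close> either way, and nothing more matters for
        moving it to the front.\<close>
      case d: False
      have "precedes (rank y a) (rank (y @ z) d)" "precedes (rank y a) (rank y d)"
        using rank_precedes[OF a d, of z] rank_precedes[OF a d, of "[]"] Cons.IH[OF a] by simp_all
      from front_precedes[OF this] show ?thesis
        by (simp add: Cons.IH[OF a])
    qed
  qed simp
qed simp

text \<open>This is what allows canonical words to be cut to their 24 newest letters.\<close>

lemma take_canon: "take k (canon y) = canon (take k y)"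
proof -
  have "rank y a = rank (take k y) a" if "a \<in> set (take k y)" for a
    using rank_append[OF that, of "drop k y"] by simp
  then show ?thesis
    by (simp add: canon_def take_map)
qed

lemma recurs_canon: "recurs q p (canon y) \<longleftrightarrow> recurs q p y"
  by (simp add: canon_def recurs_map_inj inj_rank)

lemma recurs_Cons_canon: "recurs q p (rank y a # canon y) \<longleftrightarrow> recurs q p (a # y)"
  using recurs_map_inj[OF inj_rank, of q p y "a # y"] by (simp add: canon_def)

section \<open>Tries of words\<close>

text \<open>A set of words: the flag marks the end of a word, the children continue with
  \<open>LA\<close>, \<open>LB\<close>, \<open>LC\<close>. Equal words merge on insertion, and two
  sets can be traversed in parallel.\<close>

datatype trie = Empty | Node bool trie trie trie

fun member :: "letter list \<Rightarrow> trie \<Rightarrow> bool" where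
  "member w Empty = False"
| "member [] (Node f x y z) = f"
| "member (LA # w) (Node f x y z) = member w x"
| "member (LB # w) (Node f x y z) = member w y"
| "member (LC # w) (Node f x y z) = member w z"

fun mark :: "trie \<Rightarrow> trie" where
  "mark Empty = Node True Empty Empty Empty"
| "mark (Node f x y z) = Node True x y z"

text \<open>Renaming by \<open>front a\<close> and truncation to \<open>n\<close> letters take place
  during insertion, so the renamed word is never built as a list.\<close>

function (sequential) insert_front :: "nat \<Rightarrow> letter \<Rightarrow> letter list \<Rightarrow> trie \<Rightarrow> trie"
  and insert_below :: "letter \<Rightarrow> nat \<Rightarrow> letter \<Rightarrow> letter list \<Rightarrow> trie \<Rightarrow> trie" where
  "insert_front n a [] T = mark T"
| "insert_front 0 a (b # w) T = mark T"
| "insert_front (Suc n) a (b # w) T = insert_below (front a b) n a w T"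
| "insert_below LA n a w Empty = Node False (insert_front n a w Empty) Empty Empty"
| "insert_below LB n a w Empty = Node False Empty (insert_front n a w Empty) Empty"
| "insert_below LC n a w Empty = Node False Empty Empty (insert_front n a w Empty)"
| "insert_below LA n a w (Node f x y z) = Node f (insert_front n a w x) y z"
| "insert_below LB n a w (Node f x y z) = Node f x (insert_front n a w y) z"
| "insert_below LC n a w (Node f x y z) = Node f x y (insert_front n a w z)"
  by pat_completeness auto
termination
  by (relation "measure (\<lambda>s. case s of Inl (n, a, w, T) \<Rightarrow> 2 * length w
    | Inr (b, n, a, w, T) \<Rightarrow> 2 * length w + 1)") auto

lemma member_Node:
  "member w (Node f x y z) \<longleftrightarrow> (case w of [] \<Rightarrow> f | l # v \<Rightarrow>
    (case l of LA \<Rightarrow> member v x | LB \<Rightarrow> member v y | LC \<Rightarrow> member v z))"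
  by (auto split: list.split letter.split)

lemma member_mark: "member v T \<or> v = [] \<Longrightarrow> member v (mark T)"
  by (cases T) (auto simp: member_Node split: list.splits letter.splits)

lemma member_insert:
  "member v T \<or> v = map (front a) (take n w) \<Longrightarrow> member v (insert_front n a w T)"
  "member v T \<or> v = l # map (front a) (take n w) \<Longrightarrow> member v (insert_below l n a w T)"
  by (induction n a w T and l n a w T arbitrary: v and v
      rule: insert_front_insert_below.induct)
    (auto simp: member_mark member_Node split: list.splits letter.splits)

fun rev_onto :: "letter list \<Rightarrow> letter list \<Rightarrow> letter list" where
  "rev_onto [] ys = ys"
| "rev_onto (x # xs) ys = rev_onto xs (x # ys)"

lemma rev_onto_eq: "rev_onto xs ys = rev xs @ ys"
  by (induction xs ys rule: rev_onto.induct) auto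

text \<open>\<open>p\<close> is the path from the root, newest step first, and \<open>ws\<close> an
  accumulator.\<close>

fun words :: "trie \<Rightarrow> letter list \<Rightarrow> letter list list \<Rightarrow> letter list list" where
  "words Empty p ws = ws"
| "words (Node False x y z) p ws =
    words x (LA # p) (words y (LB # p) (words z (LC # p) ws))"
| "words (Node True x y z) p ws =
    rev_onto p [] # words x (LA # p) (words y (LB # p) (words z (LC # p) ws))"

lemma words_mono: "set ws \<subseteq> set (words T p ws)"
  by (induction T p ws rule: words.induct) auto

lemma member_words: "member w T \<Longrightarrow> rev p @ w \<in> set (words T p ws)"
proof (induction w T arbitrary: p ws rule: member.induct)
  case (2 f x y z)
  then show ?case by (simp add: rev_onto_eq)
next
  case (3 w f x y z)
  then have "rev (LA # p) @ w \<in> set (words x (LA # p) (words y (LB # p) (words z (LC # p) ws)))"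
    using "3.IH"[of "LA # p"] by simp
  then show ?case by (cases f) auto
next
  case (4 w f x y z)
  then have "rev (LB # p) @ w \<in> set (words y (LB # p) (words z (LC # p) ws))"
    using "4.IH"[of "LB # p"] by simp
  then have "rev p @ LB # w \<in> set (words x (LA # p) (words y (LB # p) (words z (LC # p) ws)))"
    by (auto intro: subsetD[OF words_mono])
  then show ?case by (cases f) auto
next
  case (5 w f x y z)
  then have "rev (LC # p) @ w \<in> set (words z (LC # p) ws)"
    using "5.IH"[of "LC # p"] by simp
  then have "rev p @ LC # w \<in> set (words x (LA # p) (words y (LB # p) (words z (LC # p) ws)))"
    by (auto intro: subsetD[OF words_mono])
  then show ?case by (cases f) auto
qed simp

section \<open>The search\<close>

text \<open>
  For \<open>p \<le> 4\<close>, a word with period \<open>p\<close> has exponent at least \<open>9/4\<close> as soon as its length is \<open>2 * p + 1\<close>.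
  Larger periods need not be tested.
\<close>

fun add_square_end :: "bool \<Rightarrow> letter \<Rightarrow> letter list \<Rightarrow> trie \<Rightarrow> trie \<Rightarrow> trie \<times> trie" where
  "add_square_end True a w S T = (S, insert_below LA 23 a w T)"
| "add_square_end False a w S T = (insert_below LA 23 a w S, T)"

fun add_unless :: "bool \<Rightarrow> letter \<Rightarrow> letter list \<Rightarrow> trie \<Rightarrow> trie \<Rightarrow> trie \<times> trie" where
  "add_unless True a w S T = (S, T)"
| "add_unless False a w S T = add_square_end (repeats 12 1 (a # w) (a # w)) a w S T"

text \<open>Words with a short overlap at the end are discarded. Those showing a square of period at
  most 12 go to \<open>T\<close> (new bit \<open>LB\<close>), the others to \<open>S\<close> (new
  bit \<open>LA\<close>). The stored word is the new letter, of rank \<open>LA\<close>, and up to 23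
  older ones.\<close>

fun add :: "letter \<Rightarrow> letter list \<Rightarrow> trie \<times> trie \<Rightarrow> trie \<times> trie" where
  "add a w (S, T) = add_unless (repeats 4 2 (a # w) (a # w)) a w S T"

fun extend :: "letter list list \<Rightarrow> trie \<times> trie \<Rightarrow> trie \<times> trie" where
  "extend [] ST = ST"
| "extend (w # ws) ST = extend ws (add LC w (add LB w (add LA w ST)))"

lemma add_eq:
  "add a w (S, T) =
    (if repeats 4 2 (a # w) (a # w) then (S, T)
     else if repeats 12 1 (a # w) (a # w) then (S, insert_below LA 23 a w T)
     else (insert_below LA 23 a w S, T))"
  by simp

lemma add_mono:
  "member v (fst ST) \<Longrightarrow> member v (fst (add a w ST))"
  "member v (snd ST) \<Longrightarrow> member v (snd (add a w ST))"
  by (cases ST; simp add: add_eq member_insert del: add.simps)+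

lemma extend_mono:
  "member v (fst ST) \<Longrightarrow> member v (fst (extend ws ST))"
  "member v (snd ST) \<Longrightarrow> member v (snd (extend ws ST))"
  by (induction ws ST rule: extend.induct) (simp_all add: add_mono)

lemma member_extend:
  assumes "w \<in> set ws" "\<not> repeats 4 2 (a # w) (a # w)"
  defines "v \<equiv> LA # map (front a) (take 23 w)"
  shows "if repeats 12 1 (a # w) (a # w) then member v (snd (extend ws ST))
    else member v (fst (extend ws ST))"
  using assms(1)
proof (induction ws ST rule: extend.induct)
  case (2 u ws ST)
  show ?case
  proof (cases "w = u")
    case True
    have add: "if repeats 12 1 (a # w) (a # w) then member v (snd (add a w ST))
      else member v (fst (add a w ST))" for ST
      using assms(2) by (cases ST) (simp add: add_eq v_def member_insert del: add.simps)
    show ?thesis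
    proof (cases "repeats 12 1 (a # w) (a # w)")
      case rep: True
      then have "member v (snd (add a w ST))" for ST using add[of ST] by simp
      with True rep show ?thesis
        by (cases a) (simp_all add: extend_mono add_mono del: add.simps)
    next
      case rep: False
      then have "member v (fst (add a w ST))" for ST using add[of ST] by simp
      with True rep show ?thesis
        by (cases a) (simp_all add: extend_mono add_mono del: add.simps)
    qed
  next
    case False
    then show ?thesis using 2 by simp
  qed
qed simp

text \<open>
  \<open>no_common [] p S X\<close> states that no word in \<open>S\<close> has period \<open>p\<close> and agrees with a word in \<open>X\<close> on
  its first \<open>p\<close> letters. Without the period condition, which only matters for \<open>p < 24\<close>, the test
  would fail for \<open>p = 16\<close>.
\<close>

fun has_prefix_of :: "letter list \<Rightarrow> trie \<Rightarrow> bool" where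
  "has_prefix_of w Empty = False"
| "has_prefix_of [] (Node f x y z) = True"
| "has_prefix_of (l # w) (Node True x y z) = True"
| "has_prefix_of (LA # w) (Node False x y z) = has_prefix_of w x"
| "has_prefix_of (LB # w) (Node False x y z) = has_prefix_of w y"
| "has_prefix_of (LC # w) (Node False x y z) = has_prefix_of w z"

lemma has_prefix_ofI: "member r T \<Longrightarrow> has_prefix_of (r @ w) T"
proof (induction r T rule: member.induct)
  case (2 f x y z)
  then show ?case by (cases w) auto
next
  case (3 w f x y z)
  then show ?case by (cases f) auto
next
  case (4 w f x y z)
  then show ?case by (cases f) auto
next
  case (5 w f x y z)
  then show ?case by (cases f) auto
qed auto

fun no_common :: "letter list \<Rightarrow> nat \<Rightarrow> trie \<Rightarrow> trie \<Rightarrow> bool" where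
  "no_common p d Empty t = True"
| "no_common p d (Node f x y z) Empty = True"
| "no_common p 0 (Node f x y z) (Node f' x' y' z') =
    (\<not> has_prefix_of (rev_onto p []) (Node f x y z))"
| "no_common p (Suc d) (Node True x y z) (Node True x' y' z') = False"
| "no_common p (Suc d) (Node True x y z) (Node False x' y' z') =
    (no_common (LA # p) d x x' \<and> no_common (LB # p) d y y' \<and> no_common (LC # p) d z z')"
| "no_common p (Suc d) (Node False x y z) (Node f' x' y' z') =
    (no_common (LA # p) d x x' \<and> no_common (LB # p) d y y' \<and> no_common (LC # p) d z z')"

text \<open>Both tries are followed along the reversed path \<open>p\<close> while \<open>d\<close>
  counts down. At \<open>d = 0\<close> the rest of \<open>u\<close> must repeat the path walked, as
  period and bounded length demand. If \<open>u\<close> and \<open>v\<close> end earlier, they are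
  equal and both flags are set.\<close>

lemma no_common_sound:
  assumes "member u s" "member v t" "take d u = take d v" "prefix (drop d u) (rev p @ take d u)"
  shows "\<not> no_common p d s t"
  using assms
proof (induction p d s t arbitrary: u v rule: no_common.induct)
  case (3 p f x y z f' x' y' z')
  then obtain r where "rev p = u @ r" by (auto simp: prefix_def)
  then show ?case
    using has_prefix_ofI[OF 3(1)] by (simp add: rev_onto_eq)
next
  case (5 p d x y z x' y' z')
  then obtain l u' v' where uv: "u = l # u'" "v = l # v'"
    by (cases u; cases v) auto
  show ?case
    using 5 unfolding uv by (cases l) auto
next
  case (6 p d x y z f' x' y' z')
  then obtain l u' v' where uv: "u = l # u'" "v = l # v'"
    by (cases u; cases v) auto
  show ?case
    using 6 unfolding uv by (cases l) auto
qed auto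

text \<open>\<open>Q\<close> is a clock losing two entries per period tried: the tests stop once a
  square of the next period no longer fits into the word.\<close>

fun no_square_from :: "trie \<Rightarrow> nat \<Rightarrow> trie list \<Rightarrow> trie list \<Rightarrow> bool" where
  "no_square_from S p [] Q = True"
| "no_square_from S p (X # P) [] = True"
| "no_square_from S p (X # P) [Y] = no_common [] p S X"
| "no_square_from S p (X # P) (Y # Z # Q) = (no_common [] p S X \<and> no_square_from S (Suc p) P Q)"

text \<open>\<open>P\<close> starts with the state before the new letter, so period 13 is compared
  with entry 12, and \<open>drop 25 P\<close> is nonempty as soon as 26 letters, the new one
  included, are present.\<close>

definition no_long_square :: "trie \<Rightarrow> trie list \<Rightarrow> bool" where
  "no_long_square S P = no_square_from S 13 (drop 12 P) (drop 25 P)"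

lemma no_square_fromD:
  assumes "no_square_from S p P Q" "i < length P" "2 * i < length Q"
  shows "no_common [] (p + i) S (P ! i)"
  using assms
proof (induction S p P Q arbitrary: i rule: no_square_from.induct)
  case (4 S p X P Y Z Q)
  then show ?case by (cases i) auto
qed auto

lemma no_long_squareD:
  assumes "no_long_square S P" "13 \<le> p" "2 * p \<le> length P"
  shows "no_common [] p S (P ! (p - 1))"
proof -
  have "no_common [] (13 + (p - 13)) S (drop 12 P ! (p - 13))"
    using assms by (intro no_square_fromD[of _ _ _ "drop 25 P"]) (auto simp: no_long_square_def)
  moreover have "12 + (p - 13) = p - 1" "13 + (p - 13) = p"
    using assms by auto
  ultimately show ?thesis
    using assms by simp
qed

lemma prefix_drop_take:
  assumes "recurs (length u - p) p u" "length u \<le> 2 * p"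
  shows "prefix (drop p u) (take p u)"
proof -
  have "drop p u = take (length u - p) (drop p u)"
    by simp
  also have "\<dots> = take (length u - p) u"
    using assms(1) by (simp only: recurs_def)
  also have "\<dots> = take (length u - p) (take p u)"
    using assms(2) by (simp add: min_absorb1)
  finally show ?thesis
    by (metis take_is_prefix)
qed

text \<open>An overlap of period \<open>p\<close> has \<open>2 * p + 1\<close> letters, so 42 covers
  all those in words of length up to 85.\<close>

definition overlapping :: "letter list \<Rightarrow> bool" where
  "overlapping c = repeats 42 2 c c"

lemma overlapping_iff: "overlapping c \<longleftrightarrow> (\<exists>p. 1 \<le> p \<and> p \<le> 42 \<and> recurs (p + 1) p c)"
  unfolding overlapping_def using repeats_recurs[of 42 1 c] by (simp add: numeral_2_eq_2)

text \<open>Without this lookahead the search visits more transforms, and \<open>no_long_square\<close> fails on some.\<close>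

fun extensible :: "nat \<Rightarrow> bool \<Rightarrow> letter list \<Rightarrow> bool"
  and extensible_or :: "bool \<Rightarrow> nat \<Rightarrow> letter list \<Rightarrow> bool" where
  "extensible k True c = False"
| "extensible 0 False c = True"
| "extensible (Suc k) False c = extensible_or (extensible k (overlapping (LA # c)) (LA # c)) k c"
| "extensible_or True k c = True"
| "extensible_or False k c = extensible k (overlapping (LB # c)) (LB # c)"

text \<open>The lookahead must not pass the target length, beyond which no continuation is assumed
  to exist.\<close>

fun upto_three :: "nat \<Rightarrow> nat" where
  "upto_three 0 = 0"
| "upto_three (Suc 0) = Suc 0"
| "upto_three (Suc (Suc 0)) = Suc (Suc 0)"
| "upto_three (Suc (Suc (Suc n))) = Suc (Suc (Suc 0))"

lemma upto_three_le: "upto_three n \<le> n"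
  by (induction n rule: upto_three.induct) auto

text \<open>\<open>n\<close> letters remain to be added, \<open>c\<close> is the transform so far,
  and \<open>P\<close> lists the states of all prefixes, newest first. A branch closes when its trie
  is empty or \<open>c\<close> is not extensible. A possible long square is not pruned: it makes the
  refutation fail.\<close>

function (sequential) refutes :: "nat \<Rightarrow> letter list \<Rightarrow> trie list \<Rightarrow> bool"
  and refutes_both :: "trie \<times> trie \<Rightarrow> nat \<Rightarrow> letter list \<Rightarrow> trie list \<Rightarrow> bool"
  and refutes_branch :: "trie \<Rightarrow> nat \<Rightarrow> letter list \<Rightarrow> trie list \<Rightarrow> bool"
  and refutes_if :: "bool \<Rightarrow> trie \<Rightarrow> nat \<Rightarrow> letter list \<Rightarrow> trie list \<Rightarrow> bool" where
  "refutes 0 c P = False"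
| "refutes (Suc n) c [] = False"
| "refutes (Suc n) c (X # P) = refutes_both (extend (words X [] []) (Empty, Empty)) n c (X # P)"
| "refutes_both (S, T) n c P =
    (no_long_square S P \<and> refutes_branch S n (LA # c) P \<and> refutes_branch T n (LB # c) P)"
| "refutes_branch Empty n c P = True"
| "refutes_branch (Node f x y z) n c P =
    refutes_if (extensible (upto_three n) (overlapping c) c) (Node f x y z) n c P"
| "refutes_if False T n c P = True"
| "refutes_if True T n c P = refutes n c (T # P)"
  by pat_completeness auto
termination
  by (relation "measure (\<lambda>s. case s of Inl (Inl (n, _)) \<Rightarrow> 4 * n
    | Inl (Inr (_, n, _)) \<Rightarrow> 4 * n + 3
    | Inr (Inl (_, n, _)) \<Rightarrow> 4 * n + 2
    | Inr (Inr (_, _, n, _)) \<Rightarrow> 4 * n + 1)") auto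

section \<open>Soundness of the search\<close>

text \<open>For a (9/4)-free word this is the transform, with \<open>LA\<close> for 1 and
  \<open>LB\<close> for 2, so that the tests on letters apply to it too.\<close>

fun square_bits :: "letter list \<Rightarrow> letter list" where
  "square_bits [] = []"
| "square_bits (a # y) = (if \<exists>p\<ge>1. recurs p p (a # y) then LB else LA) # square_bits y"

lemma length_square_bits [simp]: "length (square_bits y) = length y"
  by (induction y) auto

lemma drop_square_bits: "drop n (square_bits y) = square_bits (drop n y)"
proof (induction y arbitrary: n)
  case (Cons a y)
  then show ?case by (cases n) auto
qed simp

text \<open>This collects the constraints the search tests, imposed on all prefixes of the word in
  reading order.\<close>

definition admissible :: "letter list \<Rightarrow> bool" where
  "admissible y \<longleftrightarrow> (\<forall>n p. 1 \<le> p \<longrightarrow> p \<le> 4 \<longrightarrow> \<not> recurs (p + 1) p (drop n y)) \<and>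
    (\<forall>n. \<not> overlapping (drop n (square_bits y)))"

lemma admissible_drop: "admissible y \<Longrightarrow> admissible (drop n y)"
  unfolding admissible_def drop_square_bits by simp

lemma admissible_append: "admissible (v @ y) \<Longrightarrow> admissible y"
  using admissible_drop[of "v @ y" "length v"] by simp

lemma admissible_not_overlapping: "admissible y \<Longrightarrow> \<not> overlapping (square_bits y)"
  unfolding admissible_def by (metis drop0)

lemma admissible_extensible:
  "admissible (v @ y) \<Longrightarrow> k \<le> length v \<Longrightarrow>
    extensible k (overlapping (square_bits y)) (square_bits y)"
proof (induction k arbitrary: v y)
  case 0
  then show ?case
    using admissible_not_overlapping[OF admissible_append] by simp
next
  case (Suc k)
  \<comment> \<open>Newest first, the last letter of \<open>v\<close> is the one read right after
    \<open>y\<close>. The bit it produces is among the two that the lookahead tries.\<close>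
  then obtain v' a where v: "v = v' @ [a]"
    by (cases v rule: rev_cases) auto
  have "extensible k (overlapping (square_bits (a # y))) (square_bits (a # y))"
    using Suc.IH[of v' "a # y"] Suc.prems v by simp
  then have "extensible k (overlapping (l # square_bits y)) (l # square_bits y)"
    if "square_bits (a # y) = l # square_bits y" for l
    using that by simp
  moreover have "square_bits (a # y) = LA # square_bits y \<or> square_bits (a # y) = LB # square_bits y"
    by simp
  moreover have "extensible_or b k c \<longleftrightarrow> b \<or> extensible k (overlapping (LB # c)) (LB # c)" for b c
    by (cases b) auto
  ultimately show ?case
    using admissible_not_overlapping[OF admissible_append[OF Suc.prems(1)]] by auto
qed

lemma refutes_branch_sound:
  assumes "refutes_branch T n (square_bits y) P" "member w T" "admissible (v @ y)" "length v = n"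
  shows "refutes n (square_bits y) (T # P)"
proof -
  have "extensible (upto_three n) (overlapping (square_bits y)) (square_bits y)"
    using admissible_extensible[OF assms(3)] assms(4) upto_three_le by simp
  with assms(1,2) show ?thesis by (cases T) auto
qed

lemma take_canon_Cons:
  "canon (take 24 (a # y)) = LA # map (front (rank (take 24 y) a)) (take 23 (canon (take 24 y)))"
proof -
  have "take 24 (a # y) = take 24 (a # take 24 y)"
    by (simp add: take_Cons')
  then have "canon (take 24 (a # y)) = take 24 (canon (a # take 24 y))"
    by (simp add: take_canon)
  then show ?thesis
    by (simp add: canon_Cons take_map take_Cons')
qed

text \<open>Invariant: \<open>P ! j\<close> contains the state of the actual word without its
  \<open>j\<close> newest letters. The search must follow the transform of \<open>v @ y\<close> down
  to \<open>n = 0\<close>, where \<open>refutes\<close> is false.\<close>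

lemma refutes_sound:
  assumes "refutes n (square_bits y) P" "length P = Suc (length y)"
    and "\<And>j. j \<le> length y \<Longrightarrow> member (canon (take 24 (drop j y))) (P ! j)"
    and "length v = n" "admissible (v @ y)"
  shows False
  using assms
proof (induction n arbitrary: y P v)
  case (Suc n)
  then obtain v' a where v: "v = v' @ [a]"
    by (cases v rule: rev_cases) auto
  obtain X P' where P: "P = X # P'"
    using Suc.prems(2) by (cases P) auto
  let ?w = "canon (take 24 y)" and ?w' = "canon (take 24 (a # y))"
  let ?b = "rank (take 24 y) a"
  obtain S T where ST: "extend (words X [] []) (Empty, Empty) = (S, T)"
    by fastforce
  have adm: "admissible (v' @ a # y)" "length v' = n"
    using Suc.prems v by auto
  \<comment> \<open>With the new letter, up to 25 letters are visible, enough for squares of period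
    12 and overlaps of period 4.\<close>
  have loc: "recurs q p (?b # ?w) \<longleftrightarrow> recurs q p (a # y)" if "p + q \<le> 24" for p q
    using recurs_take[of p q 25 "a # y"] that by (simp add: recurs_Cons_canon)
  have "\<not> recurs (p + 1) p (a # y)" if "1 \<le> p" "p \<le> 4" for p
    using admissible_append[OF adm(1)] that unfolding admissible_def by (metis drop0)
  then have "\<not> repeats 4 2 (?b # ?w) (?b # ?w)"
    using repeats_recurs[of 4 1 "?b # ?w"] loc by (auto simp: numeral_2_eq_2)
  moreover have "?w \<in> set (words X [] [])"
    using member_words[of ?w X "[]" "[]"] Suc.prems(3)[of 0] P by simp
  ultimately have mem: "if repeats 12 1 (?b # ?w) (?b # ?w) then member ?w' T else member ?w' S"
    using member_extend[of ?w "words X [] []" ?b "(Empty, Empty)"] 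
    unfolding ST take_canon_Cons fst_conv snd_conv by blast
  have short: "repeats 12 1 (?b # ?w) (?b # ?w) \<longleftrightarrow> (\<exists>p. 1 \<le> p \<and> p \<le> 12 \<and> recurs p p (a # y))"
    using repeats_recurs[of 12 0 "?b # ?w"] loc by auto
  have ref: "no_long_square S P" "refutes_branch S n (LA # square_bits y) P"
      "refutes_branch T n (LB # square_bits y) P"
    using Suc.prems(1) P ST by simp_all
  have step: False if "member ?w' U" "refutes_branch U n (square_bits (a # y)) P" for U
  proof (rule Suc.IH[of "a # y" "U # P" v'])
    show "refutes n (square_bits (a # y)) (U # P)"
      using refutes_branch_sound that adm by blast
    show "member (canon (take 24 (drop j (a # y)))) ((U # P) ! j)" if "j \<le> length (a # y)" for j
      using that \<open>member ?w' U\<close> Suc.prems(3) by (cases j) auto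
  qed (use Suc.prems(2) adm in auto)
  show False
  proof (cases "\<exists>p. 1 \<le> p \<and> p \<le> 12 \<and> recurs p p (a # y)")
    case True
    then have "square_bits (a # y) = LB # square_bits y" by auto
    with True mem short ref step show False by auto
  next
    case no_short: False
    then have S: "member ?w' S" using mem short by argo
    show False
    proof (cases "\<exists>p\<ge>1. recurs p p (a # y)")
      case False
      then have "square_bits (a # y) = LA # square_bits y" by auto
      with S ref step show False by auto
    next
      \<comment> \<open>Here the true bit is \<open>LB\<close>, but the search filed the word under
        \<open>S\<close>; \<open>no_long_square\<close> has to exclude this.\<close>
      case True
      then obtain p where p: "1 \<le> p" "recurs p p (a # y)" by blast
      with no_short have "\<not> p \<le> 12" by blast
      then have "13 \<le> p" by simp
      have len: "2 * p \<le> length P"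
        using p Suc.prems(2) by (simp add: recurs_def)
      have drop: "drop (p - 1) y = drop p (a # y)"
        using p by (cases p) auto
      have mem': "member (canon (take 24 (drop p (a # y)))) (P ! (p - 1))"
        using Suc.prems(3)[of "p - 1"] drop len Suc.prems(2) by simp
      have "take p (take 24 z) = take 24 (take p z)" for z :: "letter list"
        by (simp add: min.commute)
      moreover have "take p (a # y) = take p (drop p (a # y))"
        using p(2) by (simp only: recurs_def)
      ultimately have "take p ?w' = take p (canon (take 24 (drop p (a # y))))"
        by (simp only: take_canon)
      \<comment> \<open>As \<open>p\<close> is at least 13, the at most 24 letters of
        \<open>?w'\<close> do not exceed \<open>2 * p\<close>, so whatever follows its first
        \<open>p\<close> letters repeats their beginning.\<close>
      moreover have "prefix (drop p ?w') (take p ?w')"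
      proof (cases "p \<le> length ?w'")
        case True
        then have "recurs (length ?w' - p) p (a # y)"
          using p(2) \<open>13 \<le> p\<close> by (auto simp: canon_def intro: recurs_mono)
        moreover have "p + (length ?w' - p) \<le> 24"
          using True by (simp add: canon_def)
        ultimately have "recurs (length ?w' - p) p ?w'"
          by (simp only: recurs_canon recurs_take)
        then show ?thesis
          using \<open>13 \<le> p\<close> by (intro prefix_drop_take) (simp_all add: canon_def)
      qed simp
      ultimately have "\<not> no_common [] p S (P ! (p - 1))"
        using no_common_sound[OF S mem', of p "[]"] by simp
      with no_long_squareD[OF ref(1) \<open>13 \<le> p\<close> len] show False by simp
    qed
  qed
qed simp

text \<open>Numerals are unfolded to successors because the equations match on
  \<open>Suc\<close>.\<close>

lemmas refutes_eval =
  agree.simps repeats.simps repeats_else.simps front.simps mark.simps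
  insert_front.simps insert_below.simps rev_onto.simps words.simps
  add_square_end.simps[unfolded numeral_nat] add.simps[unfolded numeral_nat]
  add_unless.simps[unfolded numeral_nat One_nat_def] extend.simps
  has_prefix_of.simps no_common.simps no_square_from.simps
  no_long_square_def[unfolded numeral_nat] overlapping_def[unfolded numeral_nat]
  extensible.simps extensible_or.simps upto_three.simps
  refutes.simps refutes_both.simps refutes_branch.simps refutes_if.simps
  drop_0 drop_Suc_Cons drop_Nil simp_thms

lemma refutes_85: "refutes 85 [] [Node True Empty Empty Empty]"
  unfolding numeral_nat by (simp only: refutes_eval)

section \<open>The longest words\<close>

fun val :: "letter \<Rightarrow> nat" where
  "val LA = 0" | "val LB = 1" | "val LC = 2"

lemma inj_val: "inj val"
proof (rule injI)
  fix x y assume "val x = val y"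
  then show "x = y" by (cases x; cases y) auto
qed

lemma ex_map_val: "set x \<subseteq> {0, 1, 2} \<Longrightarrow> \<exists>w. x = map val w"
proof (induction x)
  case (Cons a x)
  then obtain w where "x = map val w" by auto
  moreover have "\<exists>l. a = val l"
    using Cons.prems by (auto intro: exI[of _ LA] exI[of _ LB] exI[of _ LC])
  ultimately show ?case
    by (metis list.simps(9))
qed simp

lemma overlap_free_map_inj:
  assumes "inj f"
  shows "overlap_free (map f x) \<longleftrightarrow> overlap_free x"
  using overlap_free_rev_iff[of "map f (rev x)"] overlap_free_rev_iff[of "rev x"]
  by (simp add: rev_map drop_map recurs_map_inj assms)

lemma curling_transform_snoc:
  "curling_transform (x @ [a]) = curling_transform x @ [curling_number (x @ [a])]"
  by (simp add: curling_transform_def)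

text \<open>\<open>Suc \<circ> val\<close> turns the bits into curling numbers. The induction runs
  over prefixes, which inherit power-freeness.\<close>

lemma curling_transform_val:
  "power_free (9/4) (map val (rev y)) \<Longrightarrow>
    curling_transform (map val (rev y)) = map (Suc \<circ> val) (rev (square_bits y))"
proof (induction y)
  case (Cons a y)
  have "power_free (9/4) (map val (rev y))"
    using Cons.prems by (rule power_free_sublist) (simp add: sublist_def, blast)
  note IH = Cons.IH[OF this]
  have "curling_number (map val (rev (a # y))) = (if \<exists>p\<ge>1. recurs p p (a # y) then 2 else 1)"
    using curling_number_rev[of "map val (a # y)"] Cons.prems
    by (simp add: rev_map recurs_map_inj[OF inj_val] flip: list.map)
  then show ?case
    using IH by (simp add: curling_transform_snoc)
qed (simp add: curling_transform_def)

lemma inj_Suc_val: "inj (Suc \<circ> val)"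
  by (intro inj_compose inj_val) simp

lemma admissible_rev:
  assumes "power_free (9/4) (map val (rev y))" "overlap_free (curling_transform (map val (rev y)))"
  shows "admissible y"
  unfolding admissible_def
proof (intro conjI allI impI notI)
  fix n p :: nat
  assume p: "1 \<le> p" "p \<le> 4" "recurs (p + 1) p (drop n y)"
  have "map val (rev y) = rev (map val (drop n y)) @ rev (map val (take n y))"
    by (simp add: rev_map flip: map_append rev_append)
  then have "sublist (rev (map val (drop n y))) (map val (rev y))"
    by (simp add: sublist_append_rightI)
  then have "power_free (9/4) (rev (map val (drop n y)))"
    using assms(1) power_free_sublist by blast
  \<comment> \<open>The left side is \<open>2 + 1 / p\<close>, which is at least 9/4 for
    \<open>p \<le> 4\<close>.\<close>
  then have "real (p + (p + 1)) / real p < 9 / 4"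
    using recurs_power_free recurs_map p by blast
  with p show False by (simp add: field_simps)
next
  fix n
  assume "overlapping (drop n (square_bits y))"
  moreover have "overlap_free (rev (square_bits y))"
    using assms by (simp add: curling_transform_val overlap_free_map_inj inj_Suc_val)
  ultimately show False
    unfolding overlapping_iff overlap_free_rev_iff by blast
qed

lemma no_word_of_length_85:
  fixes x :: "nat list"
  assumes "set x \<subseteq> {0, 1, 2}" "length x = 85"
    and "power_free (9/4) x" "overlap_free (curling_transform x)"
  shows False
proof -
  obtain w where w: "x = map val w"
    using ex_map_val assms(1) by blast
  have "admissible (rev w @ [])"
    using admissible_rev[of "rev w"] assms w by simp
  then show False
    using refutes_sound[of 85 "[]" "[Node True Empty Empty Empty]" "rev w"] refutes_85 assms w
    by (simp add: canon_def)
qed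

section \<open>The witness of length 84\<close>

fun no_overlapping_suffix :: "letter list \<Rightarrow> bool" where
  "no_overlapping_suffix [] = True"
| "no_overlapping_suffix (a # y) = (\<not> overlapping (a # y) \<and> no_overlapping_suffix y)"

lemma no_overlapping_suffixD:
  "no_overlapping_suffix y \<Longrightarrow> length y \<le> 85 \<Longrightarrow> overlap_free (rev y)"
proof -
  assume y: "no_overlapping_suffix y" "length y \<le> 85"
  have "\<not> overlapping (drop n y)" if "n < length y" for n
    using y(1) that
  proof (induction y arbitrary: n)
    case (Cons a y)
    then show ?case by (cases n) auto
  qed simp
  moreover have "p \<le> 42 \<and> n < length y" if "1 \<le> p" "recurs (p + 1) p (drop n y)" for n p
    using that y(2) by (auto simp: recurs_def)
  ultimately show "overlap_free (rev y)"
    unfolding overlap_free_rev_iff overlapping_iff by blast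
qed

text \<open>An executable \<open>square_bits\<close>: within 85 letters, squares have period at most
  42.\<close>

fun short_square_bits :: "letter list \<Rightarrow> letter list" where
  "short_square_bits [] = []"
| "short_square_bits (a # y) =
    (if repeats 42 1 (a # y) (a # y) then LB else LA) # short_square_bits y"

lemma short_square_bits: "length y \<le> 85 \<Longrightarrow> short_square_bits y = square_bits y"
proof (induction y)
  case (Cons a y)
  have "p \<le> 42" if "recurs p p (a # y)" for p
    using that Cons.prems by (simp add: recurs_def)
  then show ?case
    using Cons repeats_recurs[of 42 0 "a # y"] by auto
qed simp

definition word84 :: "letter list" where
  "word84 = [LA, LA, LB, LB, LC, LA, LC, LC, LB, LB, LA, LC, LC, LB, LB, LC, LA, LA, LB, LC, LA, LA,
    LC, LA, LA, LB, LB, LC, LB, LC, LA, LC, LA, LA, LC, LA, LB, LB, LA, LB, LB, LC, LA, LC,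
    LA, LA, LC, LA, LB, LA, LA, LB, LA, LB, LB, LC, LA, LA, LB, LC, LA, LA, LC, LA, LA, LB,
    LB, LC, LB, LC, LA, LC, LA, LA, LC, LA, LB, LA, LA, LB, LA, LB, LB, LA]"

lemma word84_eval:
  "no_overlapping_suffix word84" "no_overlapping_suffix (short_square_bits word84)"
  unfolding word84_def
  by (simp_all only: no_overlapping_suffix.simps short_square_bits.simps[unfolded numeral_nat One_nat_def]
    overlapping_def[unfolded numeral_nat] agree.simps repeats.simps repeats_else.simps simp_thms if_True if_False)

lemma word_of_length_84:
  "\<exists>x :: nat list. set x \<subseteq> {0, 1, 2} \<and> length x = 84 \<and>
    power_free (9/4) x \<and> overlap_free (curling_transform x)"
proof (intro exI conjI)
  let ?x = "map val (rev word84)"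
  have len: "length word84 = 84"
    by (simp add: word84_def)
  then show "length ?x = 84" by simp
  show "set ?x \<subseteq> {0, 1, 2}"
  proof
    fix a assume "a \<in> set ?x"
    then obtain l where "a = val l" by auto
    then show "a \<in> {0, 1, 2}" by (cases l) auto
  qed
  have "overlap_free ?x"
    using no_overlapping_suffixD[OF word84_eval(1)] len
    by (simp add: overlap_free_map_inj inj_val)
  then show pf: "power_free (9/4) ?x"
    by (rule overlap_free_imp_power_free) simp
  have "overlap_free (rev (square_bits word84))"
    using no_overlapping_suffixD[OF word84_eval(2)] len by (simp add: short_square_bits)
  then show "overlap_free (curling_transform ?x)"
    by (simp add: curling_transform_val[OF pf] overlap_free_map_inj inj_Suc_val)
qed

section \<open>Infinite words through their prefixes\<close>

lemma sublist_inf_factor: "sublist u (map x [0..<n]) \<Longrightarrow> inf_factor u x"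
proof -
  assume "sublist u (map x [0..<n])"
  then obtain v v' where eq: "map x [0..<n] = v @ u @ v'"
    by (auto simp: sublist_def)
  have len: "length v + length u \<le> n"
    using arg_cong[OF eq, of length] by simp
  have "u = take (length u) (drop (length v) (map x [0..<n]))"
    by (simp add: eq)
  also have "\<dots> = map x [length v..<length v + length u]"
    using len by (simp add: take_map drop_map)
  finally show "inf_factor u x"
    unfolding inf_factor_def by blast
qed

text \<open>Each letter of the transform depends only on a prefix, so the prefix of length 85 of an
  infinite word falls under the finite bound.\<close>

lemma curling_transform_map_upt:
  "curling_transform (map x [0..<n]) = map (inf_curling_transform x) [0..<n]"
  by (auto simp: curling_transform_def inf_curling_transform_def take_map min_absorb1 simp del: upt_Suc)

theorem theorem9:
  shows "(\<exists>x :: nat list. set x \<subseteq> {0, 1, 2} \<and> length x = 84 \<and>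
            power_free (9/4) x \<and> overlap_free (curling_transform x)) \<and>
         \<not> (\<exists>x :: nat list. set x \<subseteq> {0, 1, 2} \<and> length x > 84 \<and>
            power_free (9/4) x \<and> overlap_free (curling_transform x)) \<and>
         \<not> (\<exists>x :: nat \<Rightarrow> nat. range x \<subseteq> {0, 1, 2} \<and>
            inf_power_free (9/4) x \<and> inf_overlap_free (inf_curling_transform x))"
proof (intro conjI notI; (elim exE conjE)?)
  show "\<exists>x :: nat list. set x \<subseteq> {0, 1, 2} \<and> length x = 84 \<and>
      power_free (9/4) x \<and> overlap_free (curling_transform x)"
    by (rule word_of_length_84)
next
  fix x :: "nat list"
  assume x: "set x \<subseteq> {0, 1, 2}" "length x > 84" "power_free (9/4) x"
    "overlap_free (curling_transform x)"
  show False
  \<comment> \<open>Both freeness conditions pass to prefixes, so the prefix of length 85 yields the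
    contradiction.\<close>
  proof (rule no_word_of_length_85)
    show "set (take 85 x) \<subseteq> {0, 1, 2}"
      using x(1) set_take_subset by fastforce
    show "power_free (9/4) (take 85 x)"
      using x(3) power_free_sublist sublist_take by blast
    show "overlap_free (curling_transform (take 85 x))"
      using x(4) overlap_free_sublist sublist_take
      unfolding take_curling_transform[symmetric] by blast
  qed (use x(2) in simp)
next
  fix x :: "nat \<Rightarrow> nat"
  assume x: "range x \<subseteq> {0, 1, 2}" "inf_power_free (9/4) x"
    "inf_overlap_free (inf_curling_transform x)"
  show False
  proof (rule no_word_of_length_85)
    show "set (map x [0..<85]) \<subseteq> {0, 1, 2}"
      using x(1) by (auto simp: image_subset_iff)
    show "power_free (9/4) (map x [0..<85])"
      using x(2) sublist_inf_factor unfolding power_free_def inf_power_free_def by blast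
    show "overlap_free (curling_transform (map x [0..<85]))"
      using x(3) sublist_inf_factor
      unfolding curling_transform_map_upt overlap_free_def inf_overlap_free_def by blast
  qed simp
qed

end
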